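(* Let $C\ge0$ be a constant and define $$P^{\mathrm{packing}}_{\mathrm{distr}}:\quad\max\{\mathbf c^T\mathbf x\mid\mathbf A\mathbf x\le\mathbf b,\ \mathbf 0\le\mathbf x\le C\boldsymbol\xi\}.$$ Let $J=\{j_1,\dots,j_K\}$ be drawn i.i.d. from $\boldsymbol\xi$. For $i\in\{1,\dots,m\}$ let $r_i=\max_j\{c_j/A_{i,j}\mid A_{i,j}>0\}$, let $W=\sum_{i'=1}^m r_{i'}b_{i'}$, and let $$U^{\mathrm{packing}}=\max_{1\le i\le m}\frac{W}{b_i}=\frac{\sum_{i'=1}^m r_{i'}b_{i'}}{\min_{1\le i\le m}b_i}.$$ For any $\delta\in(0,1)$, with probability at least $1-\delta$ over the sample $J$, the following implication holds: if $P^{\mathrm{packing}}_J$ is feasible, then $$\Delta v(P^{\mathrm{packing}}_J)\le\Delta v(P^{\mathrm{packing}}_{\mathrm{distr}})+\frac{C}{\sqrt K}\cdot\left(1+U^{\mathrm{packing}}\cdot m\cdot\|\mathbf A\|_{\max}\right)\cdot\left(1+\sqrt{2\log\frac2\delta}\right).$$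
   Context: The complete problem is the packing LP $P^{\mathrm{packing}}:\ \max\{\mathbf c^T\mathbf x\mid\mathbf A\mathbf x\le\mathbf b,\ \mathbf x\ge\mathbf 0\}$, where $\mathbf A\in\mathbb R^{m\times n}$, $\mathbf b\in\mathbb R^m$ and $\mathbf c\in\mathbb R^n$. It is assumed that $\mathbf c\ge\mathbf 0$, that $\mathbf b>\mathbf 0$ (entrywise), and that for every column $j\in\{1,\dots,n\}$ there is an $i\in\{1,\dots,m\}$ with $A_{i,j}>0$. In addition, the complete problem is assumed feasible and bounded, and $\mathbf c$ is normalized so that $\|\mathbf c\|_2=1$. $\|\mathbf A\|_{\max}=\max_{i,j}|A_{i,j}|$. $\boldsymbol\xi$ is a probability distribution on $[n]=\{1,\dots,n\}$; $j_1,\dots,j_K$ are independent with $\Pr[j_k=t]=\xi_t$ (repetitions possible). $\mathbf A_J$ is the matrix whose columns are columns $j_1,\dots,j_K$ of $\mathbf A$, $\mathbf c_J=(c_{j_1},\dots,c_{j_K})$, and $P^{\mathrm{packing}}_J:\ \max\{\mathbf c_J^T\tilde{\mathbf x}\mid\mathbf A_J\tilde{\mathbf x}\le\mathbf b,\ \tilde{\mathbf x}\ge\mathbf 0\}$. $v(\cdot)$ denotes the optimal value, and since the complete problem is a maximization problem, $\Delta v(P')=v(P^{\mathrm{packing}})-v(P')$.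
   Formalization: All entries of A are assumed nonnegative (the usual meaning of a packing LP), since for A with negative entries the stated bound can fail; r_i is taken to be 0 for a row of A with no positive entry. *)

theory Defs
  imports "HOL-Probability.Probability" "HOL-Probability.Product_PMF"
begin

text \<open>
  The order on \<open>real ^ 'n\<close> is the componentwise one.  The feasible region of the packing
  program with constraint matrix \<open>A\<close> is stated for an arbitrary finite column type, so that it
  covers the complete problem (columns \<open>'n\<close>) as well as the sampled one (columns \<open>'k\<close>, where
  \<open>CARD('k)\<close> is the sample size \<open>K\<close>).
\<close>

definition packing_region :: "real ^ 'n ^ 'm \<Rightarrow> real ^ 'm \<Rightarrow> (real ^ 'n) set" where
  "packing_region A b = {x. A *v x \<le> b \<and> 0 \<le> x}"

definition distr_region ::
    "real ^ 'n ^ 'm \<Rightarrow> real ^ 'm \<Rightarrow> real \<Rightarrow> 'n pmf \<Rightarrow> (real ^ 'n) set" where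
  "distr_region A b C \<xi> = {x. A *v x \<le> b \<and> 0 \<le> x \<and> x \<le> C *\<^sub>R (\<chi> j. pmf \<xi> j)}"

definition sampled_columns :: "real ^ 'n ^ 'm \<Rightarrow> ('k \<Rightarrow> 'n) \<Rightarrow> real ^ 'k ^ 'm" where
  "sampled_columns A J = (\<chi> i k. A $ i $ J k)"

definition sampled_costs :: "real ^ 'n \<Rightarrow> ('k \<Rightarrow> 'n) \<Rightarrow> real ^ 'k" where
  "sampled_costs c J = (\<chi> k. c $ J k)"

text \<open>\<open>K = CARD('k)\<close> independent draws from \<open>\<xi>\<close>, with repetitions possible.  As the index
  set is all of \<open>'k\<close>, the default value \<open>undefined\<close> is never used.\<close>

definition iid_sample :: "'n pmf \<Rightarrow> ('k::finite \<Rightarrow> 'n) pmf" where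
  "iid_sample \<xi> = Pi_pmf UNIV undefined (\<lambda>_. \<xi>)"

text \<open>The value of a maximization problem; meaningful if the problem is feasible and bounded.\<close>

definition opt_value :: "real ^ 'n \<Rightarrow> (real ^ 'n) set \<Rightarrow> real" where
  "opt_value c F = (SUP x\<in>F. c \<bullet> x)"

definition feasible :: "(real ^ 'n) set \<Rightarrow> bool" where
  "feasible F \<longleftrightarrow> F \<noteq> {}"

definition bounded_max :: "real ^ 'n \<Rightarrow> (real ^ 'n) set \<Rightarrow> bool" where
  "bounded_max c F \<longleftrightarrow> bdd_above ((\<lambda>x. c \<bullet> x) ` F)"

text \<open>The optimality gap of a problem of value \<open>v\<close> relative to the complete packing problem.\<close>

definition optimality_gap :: "real ^ 'n ^ 'm \<Rightarrow> real ^ 'm \<Rightarrow> real ^ 'n \<Rightarrow> real \<Rightarrow> real" where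
  "optimality_gap A b c v = opt_value c (packing_region A b) - v"

definition max_abs_entry :: "real ^ 'n ^ 'm \<Rightarrow> real" where
  "max_abs_entry A = Max (range (\<lambda>(i, j). \<bar>A $ i $ j\<bar>))"

text \<open>The ratios are nonnegative; their maximum is taken to be \<open>0\<close> for a row without a positive
  entry.\<close>

definition row_ratio :: "real ^ 'n ^ 'm \<Rightarrow> real ^ 'n \<Rightarrow> 'm \<Rightarrow> real" where
  "row_ratio A c i =
     (if \<exists>j. A $ i $ j > 0 then Max {c $ j / A $ i $ j | j. A $ i $ j > 0} else 0)"

definition W_packing :: "real ^ 'n ^ 'm \<Rightarrow> real ^ 'm \<Rightarrow> real ^ 'n \<Rightarrow> real" where
  "W_packing A b c = (\<Sum>i\<in>UNIV. row_ratio A c i * b $ i)"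

definition U_packing :: "real ^ 'n ^ 'm \<Rightarrow> real ^ 'm \<Rightarrow> real ^ 'n \<Rightarrow> real" where
  "U_packing A b c = Max (range (\<lambda>i. W_packing A b c / b $ i))"

lemma row_ratio_nonneg:
  assumes "0 \<le> c"
  shows "0 \<le> row_ratio A c i"
proof (cases "\<exists>j. A $ i $ j > 0")
  case True
  then obtain j where j: "A $ i $ j > 0" by blast
  have "finite {c $ j / A $ i $ j | j. A $ i $ j > 0}" by simp
  then have "c $ j / A $ i $ j \<le> Max {c $ j / A $ i $ j | j. A $ i $ j > 0}"
    by (rule Max_ge) (use j in blast)
  moreover have "0 \<le> c $ j / A $ i $ j"
    using assms j by (simp add: less_eq_vec_def)
  ultimately show ?thesis using True by (simp add: row_ratio_def)
qed (simp add: row_ratio_def)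

lemma U_packing_eq:
  assumes "0 \<le> c" and b: "\<And>i. 0 < b $ i"
  shows "U_packing A b c = W_packing A b c / Min (range (\<lambda>i. b $ i))"
proof -
  have W: "0 \<le> W_packing A b c"
    unfolding W_packing_def
    by (intro sum_nonneg mult_nonneg_nonneg row_ratio_nonneg assms less_imp_le)
  have fin: "finite (range (\<lambda>i. b $ i))" by simp
  then have "Min (range (\<lambda>i. b $ i)) \<in> range (\<lambda>i. b $ i)" by (intro Min_in) auto
  then obtain k where k: "Min (range (\<lambda>i. b $ i)) = b $ k" by blast
  have le: "b $ k \<le> b $ i" for i unfolding k[symmetric] by (intro Min_le fin) auto
  have "Max (range (\<lambda>i. W_packing A b c / b $ i)) = W_packing A b c / b $ k"
    by (rule Max_eqI) (use W le b in \<open>auto intro!: divide_left_mono mult_pos_pos\<close>)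
  then show ?thesis unfolding U_packing_def k .
qed

end

theory Submission
  imports Defs "HOL-Probability.Hoeffding"
begin

text \<open>
  Take a maximizer \<open>x\<close> of the distributed problem and the importance weights
  \<open>w j = x j / \<xi> j \<in> [0, C]\<close>.  The sampled point \<open>y k = w (J k) / K\<close> has the objective value and
  the left-hand sides of \<open>x\<close> in expectation.  By Hoeffding's inequality and a union bound over
  the objective and the \<open>m\<close> rows, with probability at least \<open>1 - \<delta>\<close> its value is at most
  \<open>s C / \<surd>K\<close> too small and each row is violated by at most \<open>m s \<parallel>A\<parallel> C / \<surd>K\<close>, where
  \<open>s = 1 + sqrt (2 ln (2 / \<delta>))\<close>.  A violation by \<open>t\<close> is repaired by dividing \<open>y\<close> by
  \<open>1 + t / min b\<close>; as \<open>r\<close> is dual feasible, every sampled value is at most \<open>W\<close>, so the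
  repair costs at most \<open>W t / min b = U t\<close>.
\<close>

text \<open>Writing the deviation as \<open>a * s / sqrt K\<close> cancels both the range and the
  sample size from Hoeffding's exponent. One bound then serves the objective (range
  \<open>C\<close>, parameter \<open>s\<close>) and every row (range \<open>a * C\<close>, parameter
  \<open>m * s\<close>) of the main proof.\<close>

lemma prob_iid_sample_mean_deviation:
  fixes \<xi> :: "'n pmf" and h :: "'n \<Rightarrow> real" and a s :: real
  assumes h: "\<And>j. 0 \<le> h j" "\<And>j. h j \<le> a" and a: "0 < a" and s: "0 \<le> s"
  defines "P \<equiv> (iid_sample \<xi> :: ('k::finite \<Rightarrow> 'n) pmf)"
    and "K \<equiv> real CARD('k)" and "\<mu> \<equiv> measure_pmf.expectation \<xi> h"
  shows prob_iid_sample_mean_le: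
      "measure_pmf.prob P {J. (\<Sum>k\<in>UNIV. h (J k)) / K \<le> \<mu> - a * s / sqrt K} \<le> exp (- 2 * s\<^sup>2)"
    and prob_iid_sample_mean_ge:
      "measure_pmf.prob P {J. \<mu> + a * s / sqrt K \<le> (\<Sum>k\<in>UNIV. h (J k)) / K} \<le> exp (- 2 * s\<^sup>2)"
proof -
  have K: "0 < K" by (simp add: K_def)
  have component: "map_pmf (\<lambda>J. J k) P = \<xi>" for k
    unfolding P_def iid_sample_def by (subst Pi_pmf_component) auto
  have distr: "distr (measure_pmf P) borel (\<lambda>J. h (J k)) = distr (measure_pmf \<xi>) borel h" for k
  proof -
    have "distr (measure_pmf P) borel (\<lambda>J. h (J k))
        = distr (measure_pmf (map_pmf (\<lambda>J. J k) P)) borel h"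
      unfolding map_pmf_rep_eq by (subst distr_distr) (auto simp: o_def)
    then show ?thesis by (simp add: component)
  qed
  have mean: "measure_pmf.expectation P (\<lambda>J. h (J k)) = \<mu>" for k
  proof -
    have "measure_pmf.expectation P (\<lambda>J. h (J k))
        = measure_pmf.expectation (map_pmf (\<lambda>J. J k) P) h"
      by simp
    then show ?thesis by (simp add: component \<mu>_def)
  qed
  \<comment> \<open>The locale wants one representative variable. The coordinate at index
    \<open>undefined\<close> will do, since every coordinate has marginal
    \<open>\<xi>\<close>.\<close>
  interpret Hoeffding_ineq_iid
    P "UNIV :: 'k set" "\<lambda>k J. h (J k)" "\<lambda>J. h (J undefined)" 0 a \<mu>
  proof unfold_locales
    show "prob_space.indep_vars (measure_pmf P) (\<lambda>_. borel) (\<lambda>k J. h (J k)) (UNIV :: 'k set)"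
      unfolding P_def iid_sample_def
      by (intro prob_space.indep_vars_compose2[OF _ indep_vars_Pi_pmf])
        (auto simp: measure_pmf.prob_space_axioms)
    show "\<mu> \<equiv> measure_pmf.expectation P (\<lambda>J. h (J undefined))"
      using mean by simp
  qed (use h in \<open>auto simp: distr\<close>)
  have eq: "- 2 * K * (a * s / sqrt K)\<^sup>2 / (a - 0)\<^sup>2 = - 2 * s\<^sup>2"
    using K a by (simp add: power_divide power_mult_distrib)
  have nonneg: "0 \<le> a * s / sqrt K" using a s K by simp
  show "measure_pmf.prob P {J. (\<Sum>k\<in>UNIV. h (J k)) / K \<le> \<mu> - a * s / sqrt K} \<le> exp (- 2 * s\<^sup>2)"
    using Hoeffding_ineq_le'[OF nonneg a UNIV_not_empty, folded K_def, unfolded eq] by simp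
  show "measure_pmf.prob P {J. \<mu> + a * s / sqrt K \<le> (\<Sum>k\<in>UNIV. h (J k)) / K} \<le> exp (- 2 * s\<^sup>2)"
    using Hoeffding_ineq_ge'[OF nonneg a UNIV_not_empty, folded K_def, unfolded eq] by simp
qed

text \<open>The weight cancels the probability wherever that is nonzero. At a null point the
  division yields 0, and the hypothesis makes the matching summand on the right vanish too.\<close>

lemma expectation_importance_weights:
  fixes \<xi> :: "'n::finite pmf" and g x :: "'n \<Rightarrow> real"
  assumes "\<And>j. pmf \<xi> j = 0 \<Longrightarrow> x j = 0"
  shows "measure_pmf.expectation \<xi> (\<lambda>j. g j * (x j / pmf \<xi> j)) = (\<Sum>j\<in>UNIV. g j * x j)"
proof -
  have "measure_pmf.expectation \<xi> (\<lambda>j. g j * (x j / pmf \<xi> j))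
      = (\<Sum>j\<in>UNIV. g j * (x j / pmf \<xi> j) * pmf \<xi> j)"
    by (rule integral_measure_pmf_real) auto
  also have "\<dots> = (\<Sum>j\<in>UNIV. g j * x j)"
  proof (rule sum.cong)
    fix j
    show "g j * (x j / pmf \<xi> j) * pmf \<xi> j = g j * x j"
      using assms[of j] by (cases "pmf \<xi> j = 0") auto
  qed simp
  finally show ?thesis .
qed

text \<open>The objective and the rows together each receive half of \<open>\<delta>\<close>. The
  union over \<open>m\<close> rows is paid for by giving each row the larger deviation parameter
  \<open>m * s\<close>; this is the origin of the factor \<open>m\<close> in the final
  bound.\<close>

lemma deviation_union_bound:
  fixes \<delta> :: real and m :: nat
  assumes "0 < \<delta>" "\<delta> < 1" "0 < m"
  defines "s \<equiv> 1 + sqrt (2 * ln (2 / \<delta>))"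
  shows "exp (- 2 * s\<^sup>2) + real m * exp (- 2 * (real m * s)\<^sup>2) \<le> \<delta>"
proof -
  have ln: "0 \<le> ln (2 / \<delta>)" using assms by simp
  then have s: "1 \<le> s" by (simp add: s_def)
  have "2 * ln (2 / \<delta>) = (sqrt (2 * ln (2 / \<delta>)))\<^sup>2" using ln by simp
  also have "\<dots> \<le> s\<^sup>2" using ln unfolding s_def by (intro power_mono) auto
  finally have "ln (2 / \<delta>) \<le> s\<^sup>2" using ln by linarith
  then have "exp (- s\<^sup>2) \<le> exp (- ln (2 / \<delta>))" by simp
  also have "\<dots> = \<delta> / 2" using assms by (simp add: exp_minus)
  finally have half: "exp (- s\<^sup>2) \<le> \<delta> / 2" .
  have m: "1 \<le> real m" using assms by simp
  have "real m \<le> (real m)\<^sup>2" using m by (simp add: power2_eq_square)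
  also have "\<dots> \<le> (real m * s)\<^sup>2" using m s by (intro power_mono) (auto simp: mult_le_cancel_left1)
  finally have 1: "real m \<le> (real m * s)\<^sup>2" .
  have 2: "s\<^sup>2 \<le> (real m * s)\<^sup>2" using m s by (intro power_mono) (auto simp: mult_le_cancel_right1)
  \<comment> \<open>One of the two copies of \<open>(m * s)\<^sup>2\<close> in the exponent absorbs
    the prefactor through \<open>m \<le> exp m\<close>; the other still exceeds
    \<open>s\<^sup>2\<close>.\<close>
  have "real m * exp (- 2 * (real m * s)\<^sup>2) \<le> exp (real m) * exp (- 2 * (real m * s)\<^sup>2)"
    using exp_ge_add_one_self[of "real m"] by (intro mult_right_mono) (linarith, simp)
  also have "\<dots> = exp (real m - 2 * (real m * s)\<^sup>2)" by (simp add: exp_diff exp_minus field_simps)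
  also have "\<dots> \<le> exp (- s\<^sup>2)" using 1 2 by simp
  finally have "real m * exp (- 2 * (real m * s)\<^sup>2) \<le> \<delta> / 2" using half by simp
  moreover have "exp (- 2 * s\<^sup>2) \<le> exp (- s\<^sup>2)" by simp
  ultimately show ?thesis using half by linarith
qed

lemma le_row_ratio_mult:
  assumes "0 < A $ i $ j"
  shows "c $ j \<le> row_ratio A c i * A $ i $ j"
proof -
  have "c $ j / A $ i $ j \<le> Max {c $ j / A $ i $ j | j. A $ i $ j > 0}"
    by (rule Max_ge) (use assms in auto)
  then show ?thesis using assms by (auto simp: row_ratio_def pos_divide_le_eq)
qed

text \<open>Weak duality with the row ratios as dual vector: in each column one positive entry
  already covers the cost, and the other rows only add nonnegative terms. Since this covers all
  columns of \<open>A\<close>, the bound is the same for every sample.\<close>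

lemma sampled_value_le_W_packing:
  fixes A :: "real ^ 'n::finite ^ 'm::finite" and J :: "'k::finite \<Rightarrow> 'n"
  assumes A: "\<And>i j. 0 \<le> A $ i $ j" and c: "0 \<le> c" and col: "\<And>j. \<exists>i. 0 < A $ i $ j"
    and x: "x \<in> packing_region (sampled_columns A J) b"
  shows "sampled_costs c J \<bullet> x \<le> W_packing A b c"
proof -
  let ?r = "row_ratio A c"
  have x0: "0 \<le> x $ k" for k using x by (simp add: packing_region_def less_eq_vec_def)
  have dual: "c $ j \<le> (\<Sum>i\<in>UNIV. ?r i * A $ i $ j)" for j
  proof -
    obtain i where i: "0 < A $ i $ j" using col by blast
    have "c $ j \<le> ?r i * A $ i $ j" by (rule le_row_ratio_mult[OF i])
    also have "\<dots> \<le> (\<Sum>i\<in>UNIV. ?r i * A $ i $ j)"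
      by (rule member_le_sum) (auto intro!: mult_nonneg_nonneg row_ratio_nonneg A c)
    finally show ?thesis .
  qed
  have "sampled_costs c J \<bullet> x = (\<Sum>k\<in>UNIV. c $ J k * x $ k)"
    by (simp add: inner_vec_def sampled_costs_def)
  also have "\<dots> \<le> (\<Sum>k\<in>UNIV. (\<Sum>i\<in>UNIV. ?r i * A $ i $ J k) * x $ k)"
    by (intro sum_mono mult_right_mono dual x0)
  also have "\<dots> = (\<Sum>i\<in>UNIV. ?r i * (sampled_columns A J *v x) $ i)"
    unfolding sum_distrib_right
    by (subst sum.swap)
      (simp add: matrix_vector_mult_def sampled_columns_def sum_distrib_left mult.assoc)
  also have "\<dots> \<le> W_packing A b c"
    unfolding W_packing_def using x
    by (intro sum_mono mult_left_mono row_ratio_nonneg c)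
      (simp add: packing_region_def less_eq_vec_def)
  finally show ?thesis .
qed

text \<open>Scaling by \<open>1 / (1 + \<eta>)\<close> with \<open>\<eta> = t / \<beta>\<close>
  suffices because \<open>t = \<eta> * \<beta> \<le> \<eta> * b $ i\<close> in every row. The loss
  is measured at the scaled point \<open>z\<close>, which is feasible, so that \<open>W\<close>
  bounds it.\<close>

lemma packing_value_repair:
  fixes A :: "real ^ 'k::finite ^ 'm::finite" and t :: real
  assumes W: "\<And>x. x \<in> packing_region A b \<Longrightarrow> c \<bullet> x \<le> W"
    and \<beta>: "0 < \<beta>" "\<And>i. \<beta> \<le> b $ i"
    and y: "0 \<le> y" "\<And>i. (A *v y) $ i \<le> b $ i + t" and t: "0 \<le> t"
  shows "c \<bullet> y \<le> opt_value c (packing_region A b) + t * (W / \<beta>)"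
proof -
  define \<eta> where "\<eta> = t / \<beta>"
  define z where "z = (1 / (1 + \<eta>)) *\<^sub>R y"
  have \<eta>: "0 \<le> \<eta>" "0 < 1 + \<eta>" using \<beta> t by (auto simp: \<eta>_def add_pos_nonneg)
  have "(A *v y) $ i \<le> (1 + \<eta>) * b $ i" for i
  proof -
    have "t = \<eta> * \<beta>" using \<beta> by (simp add: \<eta>_def)
    also have "\<dots> \<le> \<eta> * b $ i" using \<beta> \<eta> by (intro mult_left_mono) auto
    finally show ?thesis using y(2)[of i] by (simp add: distrib_right)
  qed
  then have z: "z \<in> packing_region A b"
    using \<eta> y(1)
    by (auto simp: packing_region_def z_def less_eq_vec_def matrix_vector_mult_scaleR
        pos_divide_le_eq mult.commute)
  have "y = (1 + \<eta>) *\<^sub>R z" using \<eta> by (simp add: z_def)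
  then have "c \<bullet> y = c \<bullet> z + \<eta> * (c \<bullet> z)"
    by (simp add: scaleR_add_left inner_add_right)
  also have "\<dots> \<le> opt_value c (packing_region A b) + \<eta> * W"
  proof (rule add_mono)
    show "c \<bullet> z \<le> opt_value c (packing_region A b)"
      unfolding opt_value_def using z W by (intro cSUP_upper bdd_aboveI2[of _ _ W]) auto
    show "\<eta> * (c \<bullet> z) \<le> \<eta> * W" using \<eta> W[OF z] by (rule_tac mult_left_mono) auto
  qed
  finally show ?thesis by (simp add: \<eta>_def)
qed

text \<open>The box bound makes the region compact, and it contains 0, so the supremum is attained.
  An actual maximizer is needed to define the importance weights.\<close>

lemma distr_region_maximizer:
  assumes "\<And>i. 0 < b $ i" and "0 \<le> C"
  obtains x where "x \<in> distr_region A b C \<xi>" "opt_value c (distr_region A b C \<xi>) = c \<bullet> x"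
proof -
  let ?D = "distr_region A b C \<xi>"
  have D: "?D = {0..C *\<^sub>R (\<chi> j. pmf \<xi> j)} \<inter> {x. A *v x \<le> b}"
    by (auto simp: distr_region_def)
  have "closed {x. A *v x \<le> b}"
    unfolding less_eq_vec_def matrix_vector_mult_def
    by (auto intro!: closed_Collect_all closed_Collect_le continuous_intros)
  then have "compact ?D"
    unfolding D interval_cbox[symmetric] by (intro compact_Int_closed) auto
  moreover have "0 \<in> ?D"
    using assms by (auto simp: distr_region_def less_eq_vec_def less_imp_le)
  ultimately obtain x where x: "x \<in> ?D" "\<And>y. y \<in> ?D \<Longrightarrow> c \<bullet> y \<le> c \<bullet> x"
    using continuous_attains_sup[of ?D "\<lambda>x. c \<bullet> x"]
      continuous_on_inner[OF continuous_on_const continuous_on_id]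
    by fast
  then have "opt_value c ?D = c \<bullet> x"
    unfolding opt_value_def by (intro cSup_eq_maximum) auto
  with x(1) that show ?thesis by blast
qed

theorem mainTheorem10:
  fixes A :: "real ^ 'n::finite ^ 'm::finite"
    and b :: "real ^ 'm"
    and c :: "real ^ 'n"
    and \<xi> :: "'n pmf"
    and C \<delta> :: real
  assumes A_nonneg: "\<And>i j. 0 \<le> A $ i $ j"
    and c_nonneg: "0 \<le> c"
    and b_pos: "\<And>i. 0 < b $ i"
    and col_pos: "\<And>j. \<exists>i. 0 < A $ i $ j"
    and complete_feasible: "feasible (packing_region A b)"
    and complete_bounded: "bounded_max c (packing_region A b)"
    and c_norm: "norm c = 1"
    and C_nonneg: "0 \<le> C"
    and \<delta>: "0 < \<delta>" "\<delta> < 1"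
  shows "measure_pmf.prob (iid_sample \<xi> :: ('k::finite \<Rightarrow> 'n) pmf)
      {J. feasible (packing_region (sampled_columns A J) b) \<longrightarrow>
          optimality_gap A b c
            (opt_value (sampled_costs c J) (packing_region (sampled_columns A J) b))
          \<le> optimality_gap A b c (opt_value c (distr_region A b C \<xi>))
            + C / sqrt (real CARD('k))
              * (1 + U_packing A b c * real CARD('m) * max_abs_entry A)
              * (1 + sqrt (2 * ln (2 / \<delta>)))}
    \<ge> 1 - \<delta>"
proof -
  define K where "K = real CARD('k)"
  define m where "m = CARD('m)"
  define a where "a = max_abs_entry A"
  define s where "s = 1 + sqrt (2 * ln (2 / \<delta>))"
  define U where "U = U_packing A b c"
  define \<beta> where "\<beta> = Min (range (\<lambda>i. b $ i))"
  define P where "P = (iid_sample \<xi> :: ('k \<Rightarrow> 'n) pmf)"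
  define val where "val J = opt_value (sampled_costs c J)
    (packing_region (sampled_columns A J) b)" for J :: "'k \<Rightarrow> 'n"
  obtain x where x: "x \<in> distr_region A b C \<xi>"
    and opt: "opt_value c (distr_region A b C \<xi>) = c \<bullet> x"
    using distr_region_maximizer[OF b_pos C_nonneg] by blast
  define w where "w j = x $ j / pmf \<xi> j" for j
  define y :: "('k \<Rightarrow> 'n) \<Rightarrow> real ^ 'k" where "y J = (\<chi> k. w (J k) / K)" for J
  have K: "0 < K" and m: "0 < m" by (simp_all add: K_def m_def)
  have s: "0 \<le> s" using \<delta> by (simp add: s_def)
  have x0: "0 \<le> x $ j" and xC: "x $ j \<le> C * pmf \<xi> j" and Ax: "(A *v x) $ i \<le> b $ i" for i j
    using x by (auto simp: distr_region_def less_eq_vec_def)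
  have w0: "0 \<le> w j" for j using x0 by (simp add: w_def)
  \<comment> \<open>At a null point of \<open>\<xi>\<close> the quotient is 0 by convention, hence
    still at most \<open>C\<close>.\<close>
  have wC: "w j \<le> C" for j
    using xC[of j] C_nonneg
    by (cases "pmf \<xi> j = 0") (auto simp: w_def divide_le_eq order_less_le)
  have weights: "measure_pmf.expectation \<xi> (\<lambda>j. g j * w j) = (\<Sum>j\<in>UNIV. g j * x $ j)" for g
    unfolding w_def
  proof (rule expectation_importance_weights)
    show "x $ j = 0" if "pmf \<xi> j = 0" for j using x0[of j] xC[of j] that by simp
  qed
  have \<beta>: "0 < \<beta>" "\<beta> \<le> b $ i" for i using b_pos by (auto simp: \<beta>_def)
  have U: "U = W_packing A b c / \<beta>"
    unfolding U_def \<beta>_def by (rule U_packing_eq[OF c_nonneg b_pos])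
  have Aa: "A $ i $ j \<le> a" for i j
  proof -
    have "\<bar>A $ i $ j\<bar> \<le> a" unfolding a_def max_abs_entry_def by (rule Max_ge) auto
    then show ?thesis by simp
  qed
  \<comment> \<open>Any column provides a positive entry. Positivity is required because Hoeffding's
    inequality is applied on an interval of positive length.\<close>
  have a: "0 < a" using col_pos[of undefined] Aa by (meson less_le_trans)
  \<comment> \<open>The normalization of \<open>c\<close> keeps the weighted costs in the interval
    from 0 to \<open>C\<close>, which produces the summand 1 in
    \<open>1 + U * m * a\<close>.\<close>
  have c0: "0 \<le> c $ j" and c1: "c $ j \<le> 1" for j
    using c_nonneg component_le_norm_cart[of c j] c_norm by (auto simp: less_eq_vec_def)
  have cost: "sampled_costs c J \<bullet> y J = (\<Sum>k\<in>UNIV. c $ J k * w (J k)) / K" for J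
    by (simp add: inner_vec_def sampled_costs_def y_def sum_divide_distrib)
  have row: "(sampled_columns A J *v y J) $ i = (\<Sum>k\<in>UNIV. A $ i $ J k * w (J k)) / K" for J i
    by (simp add: matrix_vector_mult_def sampled_columns_def y_def sum_divide_distrib)
  have repair: "sampled_costs c J \<bullet> y J \<le> val J + t * U"
    if "\<And>i. (sampled_columns A J *v y J) $ i \<le> b $ i + t" "0 \<le> t" for J t
    unfolding val_def U
  proof (rule packing_value_repair)
    show "0 \<le> y J" using w0 K by (simp add: less_eq_vec_def y_def)
  qed (use that \<beta> sampled_value_le_W_packing[OF A_nonneg c_nonneg col_pos] in auto)
  define \<Theta> where "\<Theta> = C / sqrt K * (1 + U * real m * a) * s"
  have "1 - \<delta> \<le> measure_pmf.prob P {J. c \<bullet> x \<le> val J + \<Theta>}"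
  \<comment> \<open>For \<open>C = 0\<close> the Hoeffding intervals degenerate; but then
    \<open>x\<close> and all weights vanish, and it remains to see that sampled values are
    nonnegative.\<close>
  proof (cases "C = 0")
    case True
    have "w j = 0" for j using w0[of j] wC[of j] True by simp
    then have "y J = 0" for J by (simp add: y_def vec_eq_iff)
    then have "0 \<le> val J" for J using repair[of J 0] b_pos by (simp add: less_imp_le)
    moreover have "x $ j = 0" for j using x0[of j] xC[of j] True by simp
    then have "c \<bullet> x = 0" by (simp add: inner_vec_def)
    ultimately show ?thesis using \<delta> True by (simp add: \<Theta>_def)
  next
    case False
    then have C: "0 < C" using C_nonneg by simp
    \<comment> \<open>The row deviation for range \<open>a * C\<close> and parameter
      \<open>m * s\<close>; with this choice \<open>t * U\<close> is exactly the second summand of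
      \<open>\<Theta>\<close>.\<close>
    define t where "t = a * C * (real m * s) / sqrt K"
    have t: "0 \<le> t" using a C s K by (simp add: t_def)
    \<comment> \<open>Only one-sided failures hurt: an objective that is too small
      (\<open>B\<close>) or a row that is too large (\<open>R i\<close>).\<close>
    define B where "B = {J :: 'k \<Rightarrow> 'n. (\<Sum>k\<in>UNIV. c $ J k * w (J k)) / K \<le> c \<bullet> x - C * s / sqrt K}"
    define R where "R i = {J :: 'k \<Rightarrow> 'n. (A *v x) $ i + t \<le> (\<Sum>k\<in>UNIV. A $ i $ J k * w (J k)) / K}"
      for i
    have "measure_pmf.prob P B \<le> exp (- 2 * s\<^sup>2)"
    proof -
      have "c $ j * w j \<le> C" for j
        using mult_mono[OF c1[of j] wC[of j]] w0[of j] by simp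
      then show ?thesis
        using prob_iid_sample_mean_le[of "\<lambda>j. c $ j * w j" C s \<xi>, where 'k = 'k] c0 w0 C s
        by (simp add: weights B_def P_def K_def inner_vec_def)
    qed
    moreover have "measure_pmf.prob P (R i) \<le> exp (- 2 * (real m * s)\<^sup>2)" for i
    proof -
      have "A $ i $ j * w j \<le> a * C" for j
        using Aa w0 wC a by (intro mult_mono) auto
      moreover have "0 < a * C" "0 \<le> real m * s" using a C s by auto
      ultimately show ?thesis
        using prob_iid_sample_mean_ge[of "\<lambda>j. A $ i $ j * w j" "a * C" "real m * s" \<xi>,
            where 'k = 'k] A_nonneg w0
        by (simp add: weights R_def P_def K_def t_def matrix_vector_mult_def)
    qed
    then have "measure_pmf.prob P (\<Union>i. R i) \<le> real m * exp (- 2 * (real m * s)\<^sup>2)"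
      using measure_UNION_le[of "UNIV :: 'm set" R "measure_pmf P"]
        sum_bounded_above[of "UNIV :: 'm set" "\<lambda>i. measure_pmf.prob P (R i)"]
      by (fastforce simp: m_def)
    moreover have "measure_pmf.prob P (B \<union> (\<Union>i. R i))
        \<le> measure_pmf.prob P B + measure_pmf.prob P (\<Union>i. R i)"
      by (rule measure_Un_le) auto
    ultimately have bad: "measure_pmf.prob P (B \<union> (\<Union>i. R i)) \<le> \<delta>"
      using deviation_union_bound[OF \<delta> m] unfolding s_def by linarith
    have "- (B \<union> (\<Union>i. R i)) \<subseteq> {J. c \<bullet> x \<le> val J + \<Theta>}"
    proof
      fix J assume J: "J \<in> - (B \<union> (\<Union>i. R i))"
      have "(sampled_columns A J *v y J) $ i \<le> b $ i + t" for i
      proof -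
        have "J \<notin> R i" using J by blast
        then show ?thesis using Ax[of i] unfolding row R_def by simp
      qed
      then have "sampled_costs c J \<bullet> y J \<le> val J + t * U" using repair t by blast
      moreover have "c \<bullet> x - C * s / sqrt K < sampled_costs c J \<bullet> y J"
        using J unfolding cost B_def by auto
      moreover have "\<Theta> = C * s / sqrt K + t * U"
        by (simp add: \<Theta>_def t_def algebra_simps add_divide_distrib)
      ultimately show "J \<in> {J. c \<bullet> x \<le> val J + \<Theta>}" by simp
    qed
    then have "measure_pmf.prob P (- (B \<union> (\<Union>i. R i)))
        \<le> measure_pmf.prob P {J. c \<bullet> x \<le> val J + \<Theta>}"
      by (intro measure_pmf.finite_measure_mono) auto
    then show ?thesis
      using bad measure_pmf.prob_compl[of "B \<union> (\<Union>i. R i)" P] by (simp add: Compl_eq_Diff_UNIV)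
  qed
  \<comment> \<open>The value of the complete problem cancels from the two gaps, which leaves the
    comparison of \<open>c \<bullet> x\<close> with \<open>val J + \<Theta>\<close>.\<close>
  also have "\<dots> \<le> measure_pmf.prob P {J. feasible (packing_region (sampled_columns A J) b) \<longrightarrow>
      optimality_gap A b c (val J)
      \<le> optimality_gap A b c (opt_value c (distr_region A b C \<xi>)) + \<Theta>}"
    by (intro measure_pmf.finite_measure_mono) (auto simp: optimality_gap_def opt)
  finally show ?thesis
    unfolding \<Theta>_def P_def val_def K_def U_def m_def a_def s_def .
qed

end
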